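(* Let $\pi$ and $\pi^*$ be probability density functions on $\mathbb{R}^d$ such that the measure $\pi(x)\,dx$ is absolutely continuous with respect to $\pi^*(x)\,dx$. Let $w(x)=\pi(x)/\pi^*(x)$ and let $w^*=\|w\|_\infty$ be its essential supremum (with respect to $\pi^*$). Consider the Metropolis--Hastings chain with target density $\pi$ and independence proposals drawn from $\pi^*$. If $w^*<\infty$, then for every non-constant ($\pi$-a.e.) $g\in L^2(\pi)$ the integrated autocorrelation time $\tau$ of the chain in the statistic $g$ satisfies $$\tau\le \frac{1+a}{1-a},\qquad \text{where } a=1-\frac{1}{w^*}.$$
   Context: The independence Metropolis--Hastings chain works as follows: given the current state $x$, draw a proposal $x'$ from the density $\pi^*$ independently of $x$; with probability $$\alpha(x,x')=\min\left(\frac{\pi(x')}{\pi(x)}\,\frac{\pi^*(x)}{\pi^*(x')},\,1\right)$$ move to $x'$, otherwise stay at $x$. This chain is reversible with respect to $\pi$. The density $\pi$ is the target density and $\pi^*$ is the proposal density; in the source, $\pi^*$ is the normalized density of samples produced by a conditional-distribution sampler applied to an approximation of $\pi$, and the statement uses no property of $\pi^*$ other than those listed. $L^2(\pi)$ is the space of real-valued functions that are square integrable with respect to $\pi(x)\,dx$. The integrated autocorrelation time in the statistic $g$ is $$\tau=1+2\sum_{t=1}^\infty \rho_{gg}(t),$$ where $\rho_{gg}(t)$ is the autocorrelation coefficient at lag $t$, i.e. $\rho_{gg}(t)=\mathrm{Cov}(g(X_0),g(X_t))/\mathrm{Var}(g(X_0))$ for the stationary chain $(X_t)_{t\ge 0}$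 with $X_0\sim\pi$. Since $\pi\,dx\ll\pi^*\,dx$, the essential supremum of $w$ is the same whether taken with respect to $\pi$ or $\pi^*$. *)

theory Defs
  imports "HOL-Probability.Probability"
begin

definition prob_density :: "('a::euclidean_space \<Rightarrow> real) \<Rightarrow> bool" where
  "prob_density f \<longleftrightarrow>
     f \<in> borel_measurable borel \<and> (\<forall>x. 0 \<le> f x) \<and> (\<integral>\<^sup>+x. ennreal (f x) \<partial>lborel) = 1"

text \<open>
  Below, \<open>p\<close> is the target density and \<open>q\<close> the proposal density.  The convention
  \<open>x / 0 = 0\<close> is harmless: when the target is absolutely continuous with respect to the
  proposal, a chain started from the target almost surely has \<open>p x > 0\<close> and \<open>q x > 0\<close> at its
  current state, and almost surely \<open>q y > 0\<close> at its proposal.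
\<close>

definition weight :: "('a \<Rightarrow> real) \<Rightarrow> ('a \<Rightarrow> real) \<Rightarrow> 'a \<Rightarrow> real" where
  "weight p q x = p x / q x"

definition weight_sup :: "('a::euclidean_space \<Rightarrow> real) \<Rightarrow> ('a \<Rightarrow> real) \<Rightarrow> ereal" where
  "weight_sup p q = esssup (density lborel q) (\<lambda>x. ereal (weight p q x))"

definition accept_prob :: "('a \<Rightarrow> real) \<Rightarrow> ('a \<Rightarrow> real) \<Rightarrow> 'a \<Rightarrow> 'a \<Rightarrow> real" where
  "accept_prob p q x y = min ((p y / p x) * (q x / q y)) 1"

definition mh_kernel ::
  "('a::euclidean_space \<Rightarrow> real) \<Rightarrow> ('a \<Rightarrow> real) \<Rightarrow> 'a \<Rightarrow> 'a measure" where
  "mh_kernel p q x =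
     density lborel q \<bind> (\<lambda>y.
       distr (measure_pmf (bernoulli_pmf (accept_prob p q x y))) borel
         (\<lambda>accepted. if accepted then y else x))"

definition history ::
  "'w measure \<Rightarrow> (nat \<Rightarrow> 'w \<Rightarrow> 'a::topological_space) \<Rightarrow> nat \<Rightarrow> 'w measure" where
  "history \<Omega> X n =
     sigma (space \<Omega>) {X i -` A \<inter> space \<Omega> | i A. i \<le> n \<and> A \<in> sets borel}"

definition markov_chain ::
  "'w measure \<Rightarrow> (nat \<Rightarrow> 'w \<Rightarrow> 'a::topological_space) \<Rightarrow> 'a measure \<Rightarrow> ('a \<Rightarrow> 'a measure) \<Rightarrow> bool"
  where
  "markov_chain \<Omega> X \<mu> K \<longleftrightarrow>
     prob_space \<Omega> \<and>
     (\<forall>n. X n \<in> borel_measurable \<Omega>) \<and>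
     distr \<Omega> borel (X 0) = \<mu> \<and>
     (\<forall>n. \<forall>A\<in>sets borel. AE \<omega> in \<Omega>.
        real_cond_exp \<Omega> (history \<Omega> X n) (\<lambda>\<omega>'. indicator A (X (Suc n) \<omega>')) \<omega>
          = measure (K (X n \<omega>)) A)"

definition covariance :: "'w measure \<Rightarrow> ('w \<Rightarrow> real) \<Rightarrow> ('w \<Rightarrow> real) \<Rightarrow> real" where
  "covariance \<Omega> Y Z =
     (\<integral>\<omega>. (Y \<omega> - (\<integral>\<omega>'. Y \<omega>' \<partial>\<Omega>)) * (Z \<omega> - (\<integral>\<omega>'. Z \<omega>' \<partial>\<Omega>)) \<partial>\<Omega>)"

definition autocorrelation ::
  "'w measure \<Rightarrow> (nat \<Rightarrow> 'w \<Rightarrow> 'a) \<Rightarrow> ('a \<Rightarrow> real) \<Rightarrow> nat \<Rightarrow> real" where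
  "autocorrelation \<Omega> X g t =
     covariance \<Omega> (\<lambda>\<omega>. g (X 0 \<omega>)) (\<lambda>\<omega>. g (X t \<omega>))
       / prob_space.variance \<Omega> (\<lambda>\<omega>. g (X 0 \<omega>))"

definition autocorrelation_time ::
  "'w measure \<Rightarrow> (nat \<Rightarrow> 'w \<Rightarrow> 'a) \<Rightarrow> ('a \<Rightarrow> real) \<Rightarrow> real" where
  "autocorrelation_time \<Omega> X g = 1 + 2 * (\<Sum>t. autocorrelation \<Omega> X g (Suc t))"

end

theory Submission
  imports Defs
begin

text \<open>
  Let \<open>\<pi>\<close> be the target measure and \<open>W\<close> the essential supremum of the weight. The kernel dominates a
  fixed multiple of its invariant measure: \<open>K(x, A) \<ge> \<pi>(A) / W\<close> for \<open>\<pi>\<close>-almost every \<open>x\<close>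
  (\<open>mh_kernel_minorized\<close>), because the density of accepted moves from \<open>x\<close> to \<open>y\<close> is
  \<open>min (p y * q x) (p x * q y) / p x\<close> and \<open>q \<ge> p / W\<close>. Symmetry of the same minimum makes \<open>\<pi>\<close>
  invariant (\<open>mh_kernel_invariant\<close>).

  Hence a step of the chain is, with probability \<open>1 / W\<close>, an independent draw from \<open>\<pi>\<close>, and with
  probability \<open>a = 1 - 1 / W\<close> a step of a residual kernel that also preserves \<open>\<pi>\<close>. After
  \<open>t\<close> steps the chain has avoided all independent draws with probability at most \<open>a ^ t\<close>, so that the law
  of \<open>(X 0, X t)\<close> dominates \<open>(1 - a ^ t)\<close> times the product measure \<open>\<pi> \<Otimes>\<^sub>M \<pi>\<close>
  (\<open>markov_chain_joint_law_minorized\<close>).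

  A joint law with marginals \<open>\<pi>\<close> that dominates \<open>c\<close> times the product measure has covariances of absolute
  value at most \<open>1 - c\<close> times the variance (\<open>covariance_le_of_minorized_law\<close>). The autocorrelation at lag
  \<open>t\<close> is therefore at most \<open>a ^ t\<close> in absolute value, and the geometric series
  gives summability and \<open>1 + 2 * a / (1 - a) = (1 + a) / (1 - a)\<close> as the bound.

  Working with joint laws instead of the transition operator on square integrable functions reduces
  the spectral part of the argument to integrals of nonnegative functions.
\<close>

section \<open>The law of a Markov chain at times zero and t\<close>

lemma scale_measure_leI:
  assumes sets: "sets M = sets N"
    and le: "\<And>A. A \<in> sets N \<Longrightarrow> c * emeasure M A \<le> emeasure N A"
  shows "scale_measure c M \<le> N"
proof -
  have "c * emeasure M A \<le> emeasure N A" for A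
    using le[of A] sets by (cases "A \<in> sets N") (auto simp: emeasure_notin_sets)
  then show ?thesis
    using sets sets_eq_imp_space_eq[OF sets]
    by (simp add: le_measure_iff le_fun_def space_scale_measure)
qed

text \<open>
  The Markov property is given one event at a time, through conditional expectations of
  indicators. Integrating it over the event that \<open>X 0\<close> lies in a fixed set, which
  belongs to the history, yields the claim for rectangles. Both sides are measures in \<open>C\<close>
  (the right-hand one is a \<open>bind\<close>), and rectangles generate the product \<open>\<sigma>\<close>-algebra and are
  closed under intersection. Sets other than rectangles are needed because the covariance estimate
  below integrates a function of both coordinates.
\<close>
lemma markov_chain_one_step_law:
  fixes X :: "nat \<Rightarrow> 'w \<Rightarrow> 'a::topological_space"
  assumes mc: "markov_chain \<Omega> X \<pi> K"
    and K[measurable]: "K \<in> borel \<rightarrow>\<^sub>M prob_algebra borel"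
    and C: "C \<in> sets (borel \<Otimes>\<^sub>M borel)"
  shows "emeasure (distr \<Omega> (borel \<Otimes>\<^sub>M borel) (\<lambda>\<omega>. (X 0 \<omega>, X (Suc t) \<omega>))) C
       = (\<integral>\<^sup>+\<omega>. emeasure (K (X t \<omega>)) (Pair (X 0 \<omega>) -` C) \<partial>\<Omega>)"
proof -
  interpret \<Omega>: prob_space \<Omega>
    using mc by (simp add: markov_chain_def)
  have X[measurable]: "X n \<in> borel_measurable \<Omega>" for n
    using mc by (simp add: markov_chain_def)
  define F where "F = history \<Omega> X t"
  have gen: "{X i -` A \<inter> space \<Omega> | i A. i \<le> t \<and> A \<in> sets borel} \<subseteq> sets \<Omega>"
    by (auto intro!: measurable_sets[OF X])
  have spF: "space F = space \<Omega>"
    unfolding F_def history_def by (rule space_measure_of_conv)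
  have setsF: "sets F = sigma_sets (space \<Omega>) {X i -` A \<inter> space \<Omega> | i A. i \<le> t \<and> A \<in> sets borel}"
    unfolding F_def history_def using gen sets.sets_into_space
    by (intro sets_measure_of) blast
  have "subalgebra \<Omega> F"
    unfolding subalgebra_def spF setsF using gen sets.sigma_sets_subset by auto
  then interpret F: finite_measure_subalgebra \<Omega> F
    by unfold_locales
  define L where "L = (\<lambda>\<omega>. distr (K (X t \<omega>)) (borel \<Otimes>\<^sub>M borel) (Pair (X 0 \<omega>)))"
  have Kp: "prob_space (K x)" and Ks[simp, measurable_cong]: "sets (K x) = sets borel" for x
    using measurable_space[OF K, of x] by (auto simp: space_prob_algebra)
  have KX[measurable]: "(\<lambda>\<omega>. K (X t \<omega>)) \<in> \<Omega> \<rightarrow>\<^sub>M subprob_algebra borel"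
    by (rule measurable_prob_algebraD) measurable
  have L[measurable]: "L \<in> \<Omega> \<rightarrow>\<^sub>M subprob_algebra (borel \<Otimes>\<^sub>M borel)"
    unfolding L_def by (rule measurable_distr2[where M=borel]) measurable
  have emL: "emeasure (L \<omega>) C' = emeasure (K (X t \<omega>)) (Pair (X 0 \<omega>) -` C')"
    if "C' \<in> sets (borel \<Otimes>\<^sub>M borel)" for C' \<omega>
  proof -
    have "Pair (X 0 \<omega>) \<in> K (X t \<omega>) \<rightarrow>\<^sub>M borel \<Otimes>\<^sub>M borel"
      by (subst measurable_cong_sets[OF Ks refl]) measurable
    with that show ?thesis
      unfolding L_def by (subst emeasure_distr) (auto simp: sets_eq_imp_space_eq[OF Ks])
  qed
  have bind: "emeasure (\<Omega> \<bind> L) C' = (\<integral>\<^sup>+\<omega>. emeasure (K (X t \<omega>)) (Pair (X 0 \<omega>) -` C') \<partial>\<Omega>)"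
    if "C' \<in> sets (borel \<Otimes>\<^sub>M borel)" for C'
    using that by (simp add: emeasure_bind[OF \<Omega>.not_empty L] emL)
  have "distr \<Omega> (borel \<Otimes>\<^sub>M borel) (\<lambda>\<omega>. (X 0 \<omega>, X (Suc t) \<omega>)) = \<Omega> \<bind> L" (is "?J = _")
  proof (rule measure_eqI_generator_eq[OF Int_stable_pair_measure_generator[of borel borel]])
    show "{A \<times> B |A B. A \<in> sets (borel :: 'a measure) \<and> B \<in> sets (borel :: 'a measure)} \<subseteq> Pow UNIV"
      by auto
    show "sets ?J = sigma_sets UNIV {A \<times> B |A B. A \<in> sets borel \<and> B \<in> sets borel}"
      by (simp add: sets_pair_measure)
    show "sets (\<Omega> \<bind> L) = sigma_sets UNIV {A \<times> B |A B. A \<in> sets borel \<and> B \<in> sets borel}"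
      by (subst sets_bind[where N="borel \<Otimes>\<^sub>M borel"])
         (simp_all add: L_def sets_pair_measure \<Omega>.not_empty)
    show "range (\<lambda>_::nat. UNIV) \<subseteq> {A \<times> B |A B. A \<in> sets (borel :: 'a measure) \<and> B \<in> sets (borel :: 'a measure)}"
      by (auto intro!: exI[of _ UNIV])
    show "emeasure ?J UNIV \<noteq> \<infinity>" 
      by (rule finite_measure.emeasure_finite[OF prob_space.finite_measure[OF \<Omega>.prob_space_distr],
            simplified infinity_ennreal_def[symmetric]]) measurable
    fix S assume "S \<in> {A \<times> B |A B. A \<in> sets (borel :: 'a measure) \<and> B \<in> sets (borel :: 'a measure)}"
    then obtain B A where S: "S = B \<times> A" and BA[measurable]: "B \<in> sets borel" "A \<in> sets borel"
      by auto
    let ?E = "X 0 -` B \<inter> space \<Omega>"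
    have E: "?E \<in> sets F"
      unfolding setsF by (rule sigma_sets.Basic) (use BA in blast)
    have E'[measurable]: "?E \<in> sets \<Omega>" by measurable
    have AE: "AE \<omega> in \<Omega>. real_cond_exp \<Omega> F (\<lambda>\<omega>'. indicator A (X (Suc t) \<omega>')) \<omega>
          = measure (K (X t \<omega>)) A"
      using mc BA by (simp add: markov_chain_def F_def)
    have int: "integrable \<Omega> (\<lambda>\<omega>. indicator A (X (Suc t) \<omega>) :: real)"
      by (rule \<Omega>.integrable_const_bound[where B=1]) (auto simp: indicator_def)
    have Kint: "integrable \<Omega> (\<lambda>\<omega>. indicator ?E \<omega> * measure (K (X t \<omega>)) A)"
      by (rule \<Omega>.integrable_const_bound[where B=1])
         (auto simp: indicator_def prob_space.prob_le_1[OF Kp])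
    have "measure ?J S = measure \<Omega> (?E \<inter> X (Suc t) -` A)"
      unfolding S by (subst measure_distr) (auto intro!: arg_cong[where f="measure \<Omega>"])
    also have "\<dots> = (\<integral>\<omega>\<in>?E. indicator A (X (Suc t) \<omega>) \<partial>\<Omega>)"
    proof -
      let ?S = "{\<omega>\<in>space \<Omega>. X 0 \<omega> \<in> B \<and> X (Suc t) \<omega> \<in> A}"
      have "measure \<Omega> (?E \<inter> X (Suc t) -` A) = measure \<Omega> ?S"
        by (rule arg_cong[where f="measure \<Omega>"]) auto
      also have "\<dots> = (\<integral>\<omega>. indicator ?S \<omega> \<partial>\<Omega>)"
        by (simp add: Int_absorb2)
      also have "\<dots> = (\<integral>\<omega>\<in>?E. indicator A (X (Suc t) \<omega>) \<partial>\<Omega>)"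
        unfolding set_lebesgue_integral_def
        by (intro Bochner_Integration.integral_cong) (auto simp: indicator_def)
      finally show ?thesis .
    qed
    also have "\<dots> = (\<integral>\<omega>\<in>?E. real_cond_exp \<Omega> F (\<lambda>\<omega>'. indicator A (X (Suc t) \<omega>')) \<omega> \<partial>\<Omega>)"
      by (rule F.real_cond_exp_intA[OF int E])
    also have "\<dots> = (\<integral>\<omega>. indicator ?E \<omega> * measure (K (X t \<omega>)) A \<partial>\<Omega>)"
      unfolding set_lebesgue_integral_def
      by (rule integral_cong_AE) (use AE in auto)
    finally have "emeasure ?J S = ennreal \<dots>"
      by (simp add: emeasure_distr \<Omega>.emeasure_eq_measure measure_distr S)
    also have "\<dots> = (\<integral>\<^sup>+\<omega>. ennreal (indicator ?E \<omega> * measure (K (X t \<omega>)) A) \<partial>\<Omega>)"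
      by (rule nn_integral_eq_integral[symmetric, OF Kint]) simp
    also have "\<dots> = (\<integral>\<^sup>+\<omega>. emeasure (K (X t \<omega>)) (Pair (X 0 \<omega>) -` S) \<partial>\<Omega>)"
      by (rule nn_integral_cong)
         (auto simp: S indicator_def finite_measure.emeasure_eq_measure
            prob_space.finite_measure[OF Kp])
    also have "\<dots> = emeasure (\<Omega> \<bind> L) S"
      using BA unfolding S by (intro bind[symmetric]) auto
    finally show "emeasure ?J S = emeasure (\<Omega> \<bind> L) S" .
  qed auto
  then show ?thesis
    using bind[OF C] by simp
qed

lemma markov_chain_stationary:
  fixes X :: "nat \<Rightarrow> 'w \<Rightarrow> 'a::topological_space"
  assumes mc: "markov_chain \<Omega> X \<pi> K"
    and K: "K \<in> borel \<rightarrow>\<^sub>M prob_algebra borel"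
    and inv: "\<And>A. A \<in> sets borel \<Longrightarrow> (\<integral>\<^sup>+x. emeasure (K x) A \<partial>\<pi>) = emeasure \<pi> A"
  shows "distr \<Omega> borel (X t) = \<pi>"
proof (induction t)
  case 0
  then show ?case using mc by (simp add: markov_chain_def)
next
  case (Suc t)
  have X[measurable]: "X n \<in> borel_measurable \<Omega>" for n
    using mc by (simp add: markov_chain_def)
  have s\<pi>: "sets \<pi> = sets borel"
    using Suc by (metis sets_distr)
  note Ks = measurable_prob_algebraD[OF K]
  show ?case
  proof (rule measure_eqI)
    fix A assume "A \<in> sets (distr \<Omega> borel (X (Suc t)))"
    then have A[measurable]: "A \<in> sets borel" by simp
    have "emeasure (distr \<Omega> borel (X (Suc t))) A
        = emeasure (distr \<Omega> (borel \<Otimes>\<^sub>M borel) (\<lambda>\<omega>. (X 0 \<omega>, X (Suc t) \<omega>))) (UNIV \<times> A)"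
      by (simp add: emeasure_distr) (auto intro!: arg_cong[where f="emeasure \<Omega>"])
    also have "\<dots> = (\<integral>\<^sup>+\<omega>. emeasure (K (X t \<omega>)) A \<partial>\<Omega>)"
      by (subst markov_chain_one_step_law[OF mc K]) auto
    also have "\<dots> = (\<integral>\<^sup>+x. emeasure (K x) A \<partial>distr \<Omega> borel (X t))"
      by (rule nn_integral_distr[symmetric])
         (auto intro: measurable_emeasure_kernel[OF Ks])
    finally show "emeasure (distr \<Omega> borel (X (Suc t))) A = emeasure \<pi> A"
      using inv[OF A] Suc by simp
  qed (simp add: s\<pi>)
qed

text \<open>
  Minorization is inherited by the law \<open>J t\<close> of \<open>(X 0, X t)\<close>: at every step the chain forgets its
  past with probability \<open>\<epsilon>\<close>, so the part of \<open>J t\<close> that still remembers \<open>X 0\<close> has mass at most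
  \<open>(1 - \<epsilon>) ^ t\<close>. For the induction, the kernel is split, on a set \<open>C\<close>, as
  \<open>K y (C\<^sub>x) = D (x, y) + \<epsilon> * \<pi> (C\<^sub>x)\<close>, where \<open>C\<^sub>x\<close> is the section of \<open>C\<close> at \<open>x\<close> and \<open>D \<ge> 0\<close> is the
  residual kernel. The second summand always contributes \<open>\<epsilon>\<close> times the product measure of \<open>C\<close>; to
  the first one the induction hypothesis applies, and invariance of \<open>\<pi>\<close> shows that the integral of \<open>D\<close>
  against \<open>\<pi> \<Otimes>\<^sub>M \<pi>\<close> is \<open>1 - \<epsilon>\<close> times that measure.
\<close>
lemma markov_chain_joint_law_minorized:
  fixes X :: "nat \<Rightarrow> 'w \<Rightarrow> 'a::topological_space"
  assumes mc: "markov_chain \<Omega> X \<pi> K"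
    and K: "K \<in> borel \<rightarrow>\<^sub>M prob_algebra borel"
    and inv: "\<And>A. A \<in> sets borel \<Longrightarrow> (\<integral>\<^sup>+x. emeasure (K x) A \<partial>\<pi>) = emeasure \<pi> A"
    and minor: "AE x in \<pi>. \<forall>A\<in>sets borel. ennreal \<epsilon> * emeasure \<pi> A \<le> emeasure (K x) A"
    and \<epsilon>: "0 \<le> \<epsilon>" "\<epsilon> \<le> 1"
  shows "scale_measure (ennreal (1 - (1 - \<epsilon>) ^ t)) (\<pi> \<Otimes>\<^sub>M \<pi>)
       \<le> distr \<Omega> (borel \<Otimes>\<^sub>M borel) (\<lambda>\<omega>. (X 0 \<omega>, X t \<omega>))"
proof -
  interpret \<Omega>: prob_space \<Omega>
    using mc by (simp add: markov_chain_def)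
  have X[measurable]: "X n \<in> borel_measurable \<Omega>" for n
    using mc by (simp add: markov_chain_def)
  have stat: "distr \<Omega> borel (X n) = \<pi>" for n
    by (rule markov_chain_stationary[OF mc K inv])
  have s\<pi>[measurable_cong, simp]: "sets \<pi> = sets borel"
    using stat[of 0] by (metis sets_distr)
  have sp\<pi>[simp]: "space \<pi> = UNIV"
    using sets_eq_imp_space_eq[OF s\<pi>] by simp
  interpret \<pi>: prob_space \<pi>
    unfolding stat[of 0, symmetric] by (rule \<Omega>.prob_space_distr) simp
  have [simp]: "emeasure \<pi> UNIV = 1"
    using \<pi>.emeasure_space_1 by simp
  interpret \<pi>\<pi>: pair_prob_space \<pi> \<pi> ..
  define J where "J = (\<lambda>n. distr \<Omega> (borel \<Otimes>\<^sub>M borel) (\<lambda>\<omega>. (X 0 \<omega>, X n \<omega>)))"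
  have sJ[simp, measurable_cong]: "sets (J n) = sets (borel \<Otimes>\<^sub>M borel)" for n
    by (simp add: J_def)
  have spp: "sets (\<pi> \<Otimes>\<^sub>M \<pi>) = sets (borel \<Otimes>\<^sub>M borel)"
    by (intro sets_pair_measure_cong) auto
  note Ks[measurable] = measurable_prob_algebraD[OF K]
  have main: "ennreal (1 - (1 - \<epsilon>) ^ n) * emeasure (\<pi> \<Otimes>\<^sub>M \<pi>) C \<le> emeasure (J n) C"
    if "C \<in> sets (borel \<Otimes>\<^sub>M borel)" for n C
    using that
  proof (induction n arbitrary: C)
    case (Suc n)
    note C[measurable] = Suc.prems
    have CP[measurable]: "Pair x -` C \<in> sets borel" for x
      using C by measurable
    define F where "F = (\<lambda>(x, y). emeasure (K y) (Pair x -` C))"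
    define M where "M = (\<lambda>x. emeasure \<pi> (Pair x -` C))"
    define D where "D = (\<lambda>z. F z - ennreal \<epsilon> * M (fst z))"
    define m where "m = emeasure (\<pi> \<Otimes>\<^sub>M \<pi>) C"
    have F[measurable]: "F \<in> borel_measurable (borel \<Otimes>\<^sub>M borel)"
    proof -
      have "(\<lambda>z. emeasure (K (snd z)) (Pair (fst z) -` C))
          \<in> borel_measurable (borel \<Otimes>\<^sub>M (borel :: 'a measure))"
      proof (rule emeasure_measurable_subprob_algebra2[where N=borel])
        have "(SIGMA z:space (borel \<Otimes>\<^sub>M (borel :: 'a measure)). Pair (fst z) -` C)
            = {w \<in> space ((borel \<Otimes>\<^sub>M borel) \<Otimes>\<^sub>M borel). (fst (fst w), snd w) \<in> C}"
          by (auto simp: space_pair_measure)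
        also have "\<dots> \<in> sets ((borel \<Otimes>\<^sub>M borel) \<Otimes>\<^sub>M borel)"
          by measurable
        finally show "(SIGMA z:space (borel \<Otimes>\<^sub>M (borel :: 'a measure)). Pair (fst z) -` C)
            \<in> sets ((borel \<Otimes>\<^sub>M borel) \<Otimes>\<^sub>M borel)" .
      qed measurable
      then show ?thesis by (simp add: F_def case_prod_beta')
    qed
    have M[measurable]: "M \<in> borel_measurable borel"
      unfolding M_def using \<pi>.measurable_emeasure_Pair[of C borel] by simp
    have D[measurable]: "D \<in> borel_measurable (borel \<Otimes>\<^sub>M borel)"
      unfolding D_def by measurable
    have MleF: "AE y in \<pi>. \<forall>x. ennreal \<epsilon> * M x \<le> F (x, y)"
      using minor by eventually_elim (auto simp: M_def F_def)
    have intM: "(\<integral>\<^sup>+x. M x \<partial>\<pi>) = m"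
      unfolding M_def m_def by (rule \<pi>.emeasure_pair_measure_alt[symmetric]) (simp add: spp)
    have finm: "m \<noteq> \<infinity>"
      by (simp add: m_def)
    have intF: "(\<integral>\<^sup>+z. F z \<partial>(\<pi> \<Otimes>\<^sub>M \<pi>)) = m"
    proof -
      have "(\<integral>\<^sup>+z. F z \<partial>(\<pi> \<Otimes>\<^sub>M \<pi>)) = (\<integral>\<^sup>+x. \<integral>\<^sup>+y. emeasure (K y) (Pair x -` C) \<partial>\<pi> \<partial>\<pi>)"
        by (subst \<pi>.nn_integral_fst[symmetric], measurable) (simp add: F_def)
      also have "\<dots> = (\<integral>\<^sup>+x. M x \<partial>\<pi>)"
        by (simp add: inv M_def)
      finally show ?thesis by (simp add: intM)
    qed
    have "AE z in \<pi> \<Otimes>\<^sub>M \<pi>. F z = D z + ennreal \<epsilon> * M (fst z)"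
    proof (rule \<pi>\<pi>.AE_pair_measure)
      show "{z \<in> space (\<pi> \<Otimes>\<^sub>M \<pi>). F z = D z + ennreal \<epsilon> * M (fst z)} \<in> sets (\<pi> \<Otimes>\<^sub>M \<pi>)"
        by measurable
      have "AE y in \<pi>. F (x, y) = D (x, y) + ennreal \<epsilon> * M x" for x
        using MleF by eventually_elim (auto simp: D_def diff_add_cancel_ennreal)
      then show "AE x in \<pi>. AE y in \<pi>. F (x, y) = D (x, y) + ennreal \<epsilon> * M (fst (x, y))"
        by simp
    qed
    then have "m = (\<integral>\<^sup>+z. D z + ennreal \<epsilon> * M (fst z) \<partial>(\<pi> \<Otimes>\<^sub>M \<pi>))"
      unfolding intF[symmetric] by (rule nn_integral_cong_AE)
    also have "\<dots> = (\<integral>\<^sup>+z. D z \<partial>(\<pi> \<Otimes>\<^sub>M \<pi>)) + ennreal \<epsilon> * m"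
    proof -
      have "(\<integral>\<^sup>+z. ennreal \<epsilon> * M (fst z) \<partial>(\<pi> \<Otimes>\<^sub>M \<pi>)) = ennreal \<epsilon> * m"
        by (subst \<pi>.nn_integral_fst[symmetric]) (simp_all add: nn_integral_cmult intM)
      then show ?thesis
        by (subst nn_integral_add) auto
    qed
    finally have eqD: "m = (\<integral>\<^sup>+z. D z \<partial>(\<pi> \<Otimes>\<^sub>M \<pi>)) + ennreal \<epsilon> * m" .
    \<comment> \<open>Cancelling \<open>\<epsilon> * m\<close> requires finite quantities, hence the passage to real numbers.\<close>
    obtain r where r: "0 \<le> r" "m = ennreal r"
      using finm by (cases m) auto
    have intD: "(\<integral>\<^sup>+z. D z \<partial>(\<pi> \<Otimes>\<^sub>M \<pi>)) = ennreal (1 - \<epsilon>) * m"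
    proof -
      obtain d where d: "0 \<le> d" "(\<integral>\<^sup>+z. D z \<partial>(\<pi> \<Otimes>\<^sub>M \<pi>)) = ennreal d"
        using eqD finm by (cases "\<integral>\<^sup>+z. D z \<partial>(\<pi> \<Otimes>\<^sub>M \<pi>)") auto
      have "ennreal r = ennreal (d + \<epsilon> * r)"
        using eqD r d \<epsilon> by (simp add: ennreal_mult)
      then have "r = d + \<epsilon> * r"
        using r d \<epsilon> by (subst (asm) ennreal_inj) auto
      then have "d = (1 - \<epsilon>) * r"
        using r d \<epsilon> by (simp add: algebra_simps)
      then show ?thesis
        using r d \<epsilon> by (simp add: ennreal_mult)
    qed
    have le: "scale_measure (ennreal (1 - (1 - \<epsilon>) ^ n)) (\<pi> \<Otimes>\<^sub>M \<pi>) \<le> J n"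
      by (rule scale_measure_leI) (simp_all add: spp Suc.IH)
    have "ennreal (1 - (1 - \<epsilon>) ^ Suc n) * m
        = ennreal (1 - (1 - \<epsilon>) ^ n) * (ennreal (1 - \<epsilon>) * m) + ennreal \<epsilon> * m"
    proof -
      have "(1 - \<epsilon>) ^ n \<le> 1"
        using \<epsilon> by (intro power_le_one) auto
      moreover have "1 - (1 - \<epsilon>) ^ Suc n = (1 - (1 - \<epsilon>) ^ n) * (1 - \<epsilon>) + \<epsilon>"
        by (simp add: algebra_simps)
      ultimately show ?thesis
        using \<epsilon> by (simp only: mult.assoc[symmetric] distrib_right[symmetric] ennreal_mult[symmetric]
            ennreal_plus[symmetric] mult_nonneg_nonneg diff_ge_0_iff_ge)
    qed
    also have "\<dots> = (\<integral>\<^sup>+z. D z \<partial>scale_measure (ennreal (1 - (1 - \<epsilon>) ^ n)) (\<pi> \<Otimes>\<^sub>M \<pi>))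
        + ennreal \<epsilon> * m"
      by (simp add: nn_integral_scale_measure intD)
    also have "\<dots> \<le> (\<integral>\<^sup>+z. D z \<partial>J n) + ennreal \<epsilon> * m"
      by (intro add_right_mono nn_integral_mono_measure le) (simp add: spp)
    also have "\<dots> = (\<integral>\<^sup>+\<omega>. D (X 0 \<omega>, X n \<omega>) \<partial>\<Omega>) + (\<integral>\<^sup>+\<omega>. ennreal \<epsilon> * M (X 0 \<omega>) \<partial>\<Omega>)"
    proof -
      have "(\<integral>\<^sup>+\<omega>. ennreal \<epsilon> * M (X 0 \<omega>) \<partial>\<Omega>) = (\<integral>\<^sup>+x. ennreal \<epsilon> * M x \<partial>distr \<Omega> borel (X 0))"
        by (rule nn_integral_distr[symmetric]) auto
      then show ?thesis
        by (simp add: J_def nn_integral_distr stat nn_integral_cmult intM)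
    qed
    also have "\<dots> = (\<integral>\<^sup>+\<omega>. D (X 0 \<omega>, X n \<omega>) + ennreal \<epsilon> * M (X 0 \<omega>) \<partial>\<Omega>)"
      by (rule nn_integral_add[symmetric]) auto
    also have "\<dots> = (\<integral>\<^sup>+\<omega>. F (X 0 \<omega>, X n \<omega>) \<partial>\<Omega>)"
    proof (rule nn_integral_cong_AE)
      have "AE \<omega> in \<Omega>. \<forall>x. ennreal \<epsilon> * M x \<le> F (x, X n \<omega>)"
        by (rule AE_distrD[OF X[of n]]) (simp only: stat MleF)
      then show "AE \<omega> in \<Omega>. D (X 0 \<omega>, X n \<omega>) + ennreal \<epsilon> * M (X 0 \<omega>) = F (X 0 \<omega>, X n \<omega>)"
        by eventually_elim (auto simp: D_def diff_add_cancel_ennreal)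
    qed
    also have "\<dots> = emeasure (J (Suc n)) C"
      unfolding J_def markov_chain_one_step_law[OF mc K C] by (simp add: F_def)
    finally show ?case
      by (simp add: m_def)
  qed simp
  show ?thesis
    by (rule scale_measure_leI) (use main in \<open>auto simp: spp J_def\<close>)
qed

section \<open>Covariances under a minorized joint law\<close>

text \<open>
  Let \<open>h\<close> be \<open>f\<close> centred under \<open>\<pi>\<close>, with variance \<open>v\<close>. The nonnegative function
  \<open>(h x \<plusminus> h y)\<^sup>2\<close> has integral \<open>2 * v\<close> under \<open>\<pi> \<Otimes>\<^sub>M \<pi>\<close>, where the mixed term vanishes, and
  \<open>2 * v \<plusminus> 2 * Cov\<close> under the joint law, because both marginals are \<open>\<pi>\<close>. Comparing the
  two measures on this function gives \<open>c * v \<le> v \<plusminus> Cov\<close> for both signs. The square keeps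
  the whole argument within nonnegative integrals and replaces an operator norm bound on
  the space of square integrable functions.
\<close>
lemma covariance_le_of_minorized_law:
  fixes f :: "'a::topological_space \<Rightarrow> real"
  assumes "prob_space \<Omega>"
    and U[measurable]: "U \<in> borel_measurable \<Omega>" and V[measurable]: "V \<in> borel_measurable \<Omega>"
    and dU: "distr \<Omega> borel U = \<pi>" and dV: "distr \<Omega> borel V = \<pi>"
    and minor: "scale_measure (ennreal c) (\<pi> \<Otimes>\<^sub>M \<pi>) \<le> distr \<Omega> (borel \<Otimes>\<^sub>M borel) (\<lambda>\<omega>. (U \<omega>, V \<omega>))"
    and c: "0 \<le> c"
    and f[measurable]: "f \<in> borel_measurable borel"
    and f2: "integrable \<pi> (\<lambda>x. (f x)\<^sup>2)"
  shows "\<bar>covariance \<Omega> (\<lambda>\<omega>. f (U \<omega>)) (\<lambda>\<omega>. f (V \<omega>))\<bar>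
       \<le> (1 - c) * prob_space.variance \<Omega> (\<lambda>\<omega>. f (U \<omega>))"
proof -
  interpret \<Omega>: prob_space \<Omega> by fact
  have s\<pi>[measurable_cong, simp]: "sets \<pi> = sets borel"
    using dU by (metis sets_distr)
  interpret \<pi>: prob_space \<pi>
    unfolding dU[symmetric] by (rule \<Omega>.prob_space_distr) simp
  have spp: "sets (\<pi> \<Otimes>\<^sub>M \<pi>) = sets (borel \<Otimes>\<^sub>M borel)"
    by (intro sets_pair_measure_cong) auto
  have f1: "integrable \<pi> f"
    by (rule \<pi>.square_integrable_imp_integrable[OF _ f2]) measurable
  define m where "m = (\<integral>x. f x \<partial>\<pi>)"
  define h where "h = (\<lambda>x. f x - m)"
  define v where "v = (\<integral>x. (h x)\<^sup>2 \<partial>\<pi>)"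
  have h[measurable]: "h \<in> borel_measurable borel" by (simp add: h_def)
  have h1: "integrable \<pi> h" using f1 by (simp add: h_def)
  have h0: "(\<integral>x. h x \<partial>\<pi>) = 0" using f1 by (simp add: h_def m_def \<pi>.prob_space)
  have h2: "integrable \<pi> (\<lambda>x. (h x)\<^sup>2)"
    unfolding h_def power2_diff using f1 f2 by simp
  have v0: "0 \<le> v" by (simp add: v_def)
  have trU: "integrable \<Omega> (\<lambda>\<omega>. k (U \<omega>)) \<longleftrightarrow> integrable \<pi> k" "(\<integral>\<omega>. k (U \<omega>) \<partial>\<Omega>) = (\<integral>x. k x \<partial>\<pi>)"
    if [measurable]: "k \<in> borel_measurable borel" for k :: "'a \<Rightarrow> real"
    unfolding dU[symmetric] by (simp_all add: integrable_distr_eq integral_distr)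
  have trV: "integrable \<Omega> (\<lambda>\<omega>. k (V \<omega>)) \<longleftrightarrow> integrable \<pi> k" "(\<integral>\<omega>. k (V \<omega>) \<partial>\<Omega>) = (\<integral>x. k x \<partial>\<pi>)"
    if [measurable]: "k \<in> borel_measurable borel" for k :: "'a \<Rightarrow> real"
    unfolding dV[symmetric] by (simp_all add: integrable_distr_eq integral_distr)
  have hU2: "integrable \<Omega> (\<lambda>\<omega>. (h (U \<omega>))\<^sup>2)" and hV2: "integrable \<Omega> (\<lambda>\<omega>. (h (V \<omega>))\<^sup>2)"
    using trU(1)[of "\<lambda>x. (h x)\<^sup>2"] trV(1)[of "\<lambda>x. (h x)\<^sup>2"] h2 by auto
  have hUV: "integrable \<Omega> (\<lambda>\<omega>. h (U \<omega>) * h (V \<omega>))"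
  proof (rule Bochner_Integration.integrable_bound)
    show "integrable \<Omega> (\<lambda>\<omega>. (h (U \<omega>))\<^sup>2 + (h (V \<omega>))\<^sup>2)"
      using hU2 hV2 by simp
    have "\<bar>x * y\<bar> \<le> x\<^sup>2 + y\<^sup>2" for x y :: real
      using sum_squares_bound[of "\<bar>x\<bar>" "\<bar>y\<bar>"] mult_nonneg_nonneg[of "\<bar>x\<bar>" "\<bar>y\<bar>"]
      unfolding abs_mult power2_abs by linarith
    then show "AE \<omega> in \<Omega>. norm (h (U \<omega>) * h (V \<omega>)) \<le> norm ((h (U \<omega>))\<^sup>2 + (h (V \<omega>))\<^sup>2)"
      by simp
  qed measurable
  have cov: "covariance \<Omega> (\<lambda>\<omega>. f (U \<omega>)) (\<lambda>\<omega>. f (V \<omega>)) = (\<integral>\<omega>. h (U \<omega>) * h (V \<omega>) \<partial>\<Omega>)"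
    by (simp add: covariance_def trU trV h_def m_def)
  have var: "\<Omega>.variance (\<lambda>\<omega>. f (U \<omega>)) = v"
    using trU(2)[of "\<lambda>x. (h x)\<^sup>2"] by (simp add: trU v_def h_def m_def)
  \<comment> \<open>Here \<open>s\<close> is the sign, taken to be 1 and -1 below.\<close>
  have key: "c * (2 * v) \<le> 2 * v + 2 * s * (\<integral>\<omega>. h (U \<omega>) * h (V \<omega>) \<partial>\<Omega>)" if s: "s\<^sup>2 = 1" for s :: real
  proof -
    let ?H = "\<lambda>z. ennreal ((h (fst z) + s * h (snd z))\<^sup>2)"
    have expand: "(x + s * y)\<^sup>2 = x\<^sup>2 + y\<^sup>2 + 2 * s * (x * y)" for x y :: real
      using s by (simp add: power2_sum power_mult_distrib)
    have inner: "(\<integral>\<^sup>+y. ennreal ((h x + s * h y)\<^sup>2) \<partial>\<pi>) = ennreal ((h x)\<^sup>2 + v)" for x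
    proof -
      have "integrable \<pi> (\<lambda>y. (h x + s * h y)\<^sup>2)" "(\<integral>y. (h x + s * h y)\<^sup>2 \<partial>\<pi>) = (h x)\<^sup>2 + v"
        using h1 h2 by (simp_all add: expand v_def h0 \<pi>.prob_space)
      then show ?thesis
        by (subst nn_integral_eq_integral) auto
    qed
    have "(\<integral>\<^sup>+z. ?H z \<partial>(\<pi> \<Otimes>\<^sub>M \<pi>)) = (\<integral>\<^sup>+x. ennreal ((h x)\<^sup>2 + v) \<partial>\<pi>)"
      by (subst \<pi>.nn_integral_fst[symmetric]) (auto simp: inner)
    also have "\<dots> = ennreal (2 * v)"
      using h2 v0 by (subst nn_integral_eq_integral) (auto simp: v_def \<pi>.prob_space)
    finally have "ennreal (c * (2 * v)) = (\<integral>\<^sup>+z. ?H z \<partial>scale_measure (ennreal c) (\<pi> \<Otimes>\<^sub>M \<pi>))"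
      using c v0 by (simp add: nn_integral_scale_measure ennreal_mult)
    also have "\<dots> \<le> (\<integral>\<^sup>+z. ?H z \<partial>distr \<Omega> (borel \<Otimes>\<^sub>M borel) (\<lambda>\<omega>. (U \<omega>, V \<omega>)))"
      by (rule nn_integral_mono_measure[OF _ minor]) (simp add: spp)
    also have "\<dots> = (\<integral>\<^sup>+\<omega>. ennreal ((h (U \<omega>) + s * h (V \<omega>))\<^sup>2) \<partial>\<Omega>)"
      by (simp add: nn_integral_distr)
    also have "\<dots> = ennreal (\<integral>\<omega>. (h (U \<omega>) + s * h (V \<omega>))\<^sup>2 \<partial>\<Omega>)"
    proof (rule nn_integral_eq_integral)
      show "integrable \<Omega> (\<lambda>\<omega>. (h (U \<omega>) + s * h (V \<omega>))\<^sup>2)"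
        using hU2 hV2 hUV by (simp add: expand)
    qed simp
    also have int: "(\<integral>\<omega>. (h (U \<omega>) + s * h (V \<omega>))\<^sup>2 \<partial>\<Omega>)
        = 2 * v + 2 * s * (\<integral>\<omega>. h (U \<omega>) * h (V \<omega>) \<partial>\<Omega>)"
      using hU2 hV2 hUV trU(2)[of "\<lambda>x. (h x)\<^sup>2"] trV(2)[of "\<lambda>x. (h x)\<^sup>2"]
      by (simp add: expand v_def)
    finally have "ennreal (c * (2 * v)) \<le> ennreal (2 * v + 2 * s * (\<integral>\<omega>. h (U \<omega>) * h (V \<omega>) \<partial>\<Omega>))" .
    moreover have "0 \<le> (\<integral>\<omega>. (h (U \<omega>) + s * h (V \<omega>))\<^sup>2 \<partial>\<Omega>)"
      by simp
    ultimately show ?thesis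
      unfolding int by simp
  qed
  show ?thesis
    unfolding cov var using key[of 1] key[of "-1"] by (simp add: algebra_simps abs_le_iff)
qed

section \<open>The Metropolis--Hastings kernel with independence proposals\<close>

lemma accept_prob_bounds:
  assumes "\<And>x. 0 \<le> p x" "\<And>x. 0 \<le> q x"
  shows "0 \<le> accept_prob p q x y" "accept_prob p q x y \<le> 1"
  using assms by (auto simp: accept_prob_def)

text \<open>
  The density of accepted moves from \<open>x\<close> to \<open>y\<close> is symmetric in \<open>x\<close> and \<open>y\<close>: this is detailed balance.
  With \<open>x / 0 = 0\<close> the identity also holds at zeros of \<open>p\<close> and \<open>q\<close>, so that no exceptional set
  has to be carried along.
\<close>
lemma accepted_flow:
  assumes "\<And>x. 0 \<le> p x" "\<And>x. 0 \<le> q x"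
  shows "p x * (q y * accept_prob p q x y) = min (p y * q x) (p x * q y)"
proof (cases "p x = 0 \<or> q y = 0")
  case True
  moreover have "0 \<le> p y * q x" "0 \<le> p x * q y"
    using assms by auto
  ultimately show ?thesis
    by (auto simp: min_def)
next
  case False
  then have "0 < p x" "0 < q y" using assms(1)[of x] assms(2)[of y] by auto
  then show ?thesis
    by (simp add: accept_prob_def min_def field_simps)
qed

lemma prob_density_prob_space:
  "prob_density p \<Longrightarrow> prob_space (density lborel p)"
  by (intro prob_spaceI) (simp add: prob_density_def emeasure_density)

context
  fixes p q :: "'a::euclidean_space \<Rightarrow> real"
  assumes p: "prob_density p" and q: "prob_density q"
begin

lemma pq_nonneg: "0 \<le> p x" "0 \<le> q x"
  using p q by (auto simp: prob_density_def)

lemma pq_measurable[measurable]: "p \<in> borel_measurable borel" "q \<in> borel_measurable borel"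
  using p q by (auto simp: prob_density_def)

lemmas \<alpha>_bounds = accept_prob_bounds[of p q, OF pq_nonneg]

lemma \<alpha>_measurable[measurable]:
  assumes [measurable]: "f \<in> M \<rightarrow>\<^sub>M borel" "g \<in> M \<rightarrow>\<^sub>M borel"
  shows "(\<lambda>z. accept_prob p q (f z) (g z)) \<in> borel_measurable M"
  unfolding accept_prob_def by measurable

text \<open>
  The binding of a proposal and a Bernoulli decision is turned into one integral over the proposal,
  from which measurability, invariance and minorization are all read off.
\<close>
lemma
  shows emeasure_mh_kernel: "A \<in> sets borel \<Longrightarrow> emeasure (mh_kernel p q x) A
      = (\<integral>\<^sup>+y. ennreal (q y) * (ennreal (accept_prob p q x y) * indicator A y
          + ennreal (1 - accept_prob p q x y) * indicator A x) \<partial>lborel)"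
    and sets_mh_kernel: "sets (mh_kernel p q x) = sets borel"
proof -
  interpret Q: prob_space "density lborel q" by (rule prob_density_prob_space[OF q])
  define B where "B = (\<lambda>y. distr (measure_pmf (bernoulli_pmf (accept_prob p q x y))) borel
      (\<lambda>accepted. if accepted then y else x))"
  have emB: "emeasure (B y) A = ennreal (accept_prob p q x y) * indicator A y
      + ennreal (1 - accept_prob p q x y) * indicator A x" if A: "A \<in> sets borel" for y A
  proof -
    have "emeasure (B y) A = (\<integral>\<^sup>+b. indicator A (if b then y else x)
        \<partial>measure_pmf (bernoulli_pmf (accept_prob p q x y)))"
      unfolding B_def using A
      by (subst emeasure_distr) (auto simp flip: nn_integral_indicator intro!: nn_integral_cong split: split_indicator)
    then show ?thesis
      by (simp add: \<alpha>_bounds nn_integral_bernoulli_pmf mult.commute)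
  qed
  have B: "B \<in> density lborel q \<rightarrow>\<^sub>M subprob_algebra borel"
  proof (rule measurable_subprob_algebra)
    show "subprob_space (B y)" for y
      unfolding B_def
      by (intro prob_space_imp_subprob_space measure_pmf.prob_space_distr) simp
    show "(\<lambda>y. emeasure (B y) A) \<in> borel_measurable (density lborel q)" if [measurable]: "A \<in> sets borel" for A
      by (simp add: emB)
  qed (simp add: B_def)
  have mh: "mh_kernel p q x = density lborel q \<bind> B"
    by (simp add: mh_kernel_def B_def)
  show "sets (mh_kernel p q x) = sets borel"
    unfolding mh by (rule sets_bind) (auto simp: B_def)
  assume A[measurable]: "A \<in> sets borel"
  show "emeasure (mh_kernel p q x) A
      = (\<integral>\<^sup>+y. ennreal (q y) * (ennreal (accept_prob p q x y) * indicator A y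
          + ennreal (1 - accept_prob p q x y) * indicator A x) \<partial>lborel)"
    unfolding mh emeasure_bind[OF Q.not_empty B A]
    by (subst nn_integral_density) (auto simp: emB)
qed

lemma prob_space_mh_kernel: "prob_space (mh_kernel p q x)"
proof (rule prob_spaceI)
  have "emeasure (mh_kernel p q x) (space (mh_kernel p q x)) = (\<integral>\<^sup>+y. ennreal (q y) \<partial>lborel)"
    using sets_eq_imp_space_eq[OF sets_mh_kernel[of x]]
    by (simp add: emeasure_mh_kernel \<alpha>_bounds flip: ennreal_plus)
  then show "emeasure (mh_kernel p q x) (space (mh_kernel p q x)) = 1"
    using q by (simp add: prob_density_def)
qed

lemma measurable_mh_kernel: "mh_kernel p q \<in> borel \<rightarrow>\<^sub>M prob_algebra borel"
proof (intro measurable_prob_algebraI measurable_subprob_algebra)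
  show "(\<lambda>x. emeasure (mh_kernel p q x) A) \<in> borel_measurable borel"
    if [measurable]: "A \<in> sets borel" for A
    by (simp add: emeasure_mh_kernel)
qed (auto simp: prob_space_mh_kernel prob_space_imp_subprob_space sets_mh_kernel)

text \<open>
  Both the accepted flow out of \<open>A\<close> and the accepted flow into \<open>A\<close> (moves inside \<open>A\<close> included)
  are integrals of the symmetric density \<open>min (p y * q x) (p x * q y)\<close>, so they agree. Rejections have
  probability one minus that of acceptance; the flow out of \<open>A\<close> is added to both sides, since
  subtraction is awkward for extended reals, and cancelled at the end because it is finite.
\<close>
lemma mh_kernel_invariant:
  assumes A[measurable]: "A \<in> sets borel"
  shows "(\<integral>\<^sup>+x. emeasure (mh_kernel p q x) A \<partial>density lborel p) = emeasure (density lborel p) A"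
proof -
  let ?s = "\<lambda>x y. ennreal (min (p y * q x) (p x * q y))"
  let ?k = "\<lambda>x y. ennreal (q y) * (ennreal (accept_prob p q x y) * indicator A y
          + ennreal (1 - accept_prob p q x y) * indicator A x)"
  have intq: "(\<integral>\<^sup>+y. ennreal (q y) \<partial>lborel) = 1"
    using q by (simp add: prob_density_def)
  have pointwise: "ennreal (p x) * ?k x y + ?s x y * indicator A x
      = ?s x y * indicator A y + ennreal (p x) * ennreal (q y) * indicator A x" for x y
  proof -
    have s: "?s x y = ennreal (p x) * (ennreal (q y) * ennreal (accept_prob p q x y))"
      by (simp add: accepted_flow[symmetric] pq_nonneg ennreal_mult \<alpha>_bounds)
    have "ennreal (accept_prob p q x y) + ennreal (1 - accept_prob p q x y) = 1"
      by (simp add: \<alpha>_bounds flip: ennreal_plus)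
    then have "ennreal (p x) * (ennreal (q y) * ennreal (1 - accept_prob p q x y)) + ?s x y
        = ennreal (p x) * ennreal (q y)"
      unfolding s by (simp add: add.commute mult.assoc flip: distrib_left)
    then show ?thesis
      by (auto simp: s indicator_def algebra_simps)
  qed
  have K: "(\<integral>\<^sup>+x. emeasure (mh_kernel p q x) A \<partial>density lborel p)
      = (\<integral>\<^sup>+x. \<integral>\<^sup>+y. ennreal (p x) * ?k x y \<partial>lborel \<partial>lborel)"
    by (simp add: nn_integral_density emeasure_mh_kernel nn_integral_cmult)
  have \<pi>: "emeasure (density lborel p) A
      = (\<integral>\<^sup>+x. \<integral>\<^sup>+y. ennreal (p x) * ennreal (q y) * indicator A x \<partial>lborel \<partial>lborel)"
    by (simp add: emeasure_density nn_integral_cmult nn_integral_multc intq)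
  have sym: "(\<integral>\<^sup>+x. \<integral>\<^sup>+y. ?s x y * indicator A x \<partial>lborel \<partial>lborel)
      = (\<integral>\<^sup>+x. \<integral>\<^sup>+y. ?s x y * indicator A y \<partial>lborel \<partial>lborel)"
    by (subst lborel_pair.Fubini') (auto simp: min.commute mult.commute)
  have fin: "(\<integral>\<^sup>+x. \<integral>\<^sup>+y. ?s x y * indicator A y \<partial>lborel \<partial>lborel) \<noteq> \<infinity>"
  proof -
    have "(\<integral>\<^sup>+x. \<integral>\<^sup>+y. ?s x y * indicator A y \<partial>lborel \<partial>lborel)
        \<le> (\<integral>\<^sup>+x. \<integral>\<^sup>+y. ennreal (p x) * ennreal (q y) \<partial>lborel \<partial>lborel)"
      by (intro nn_integral_mono)
         (auto simp: indicator_def pq_nonneg ennreal_mult[symmetric] intro!: ennreal_leI)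
    also have "\<dots> = 1"
      using p by (simp add: nn_integral_cmult intq prob_density_def)
    finally show ?thesis by (auto simp: top_unique)
  qed
  have "(\<integral>\<^sup>+x. emeasure (mh_kernel p q x) A \<partial>density lborel p)
        + (\<integral>\<^sup>+x. \<integral>\<^sup>+y. ?s x y * indicator A x \<partial>lborel \<partial>lborel)
      = (\<integral>\<^sup>+x. \<integral>\<^sup>+y. ennreal (p x) * ?k x y + ?s x y * indicator A x \<partial>lborel \<partial>lborel)"
    unfolding K by (subst nn_integral_add[symmetric]) (auto simp: nn_integral_add)
  also have "\<dots> = (\<integral>\<^sup>+x. \<integral>\<^sup>+y. ?s x y * indicator A y \<partial>lborel \<partial>lborel) + emeasure (density lborel p) A"
    unfolding pointwise \<pi> by (subst nn_integral_add[symmetric]) (auto simp: nn_integral_add)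
  finally show ?thesis
    unfolding sym using fin by (simp add: add.commute ennreal_add_left_cancel)
qed

text \<open>
  Where \<open>p \<le> W * q\<close> holds at \<open>x\<close> and at \<open>y\<close>, both \<open>p y * q x\<close> and \<open>p x * q y\<close> are at least
  \<open>p x * p y / W\<close>. Dividing the accepted flow by \<open>p x\<close>, accepted moves alone have a transition density
  of at least \<open>p y / W\<close>. In probabilistic terms, each step contains with probability \<open>1 / W\<close> a fresh
  draw from the target.
\<close>
lemma mh_kernel_minorized:
  assumes W: "0 < W" "AE x in lborel. p x \<le> W * q x"
  shows "AE x in density lborel p. \<forall>A\<in>sets borel.
      ennreal (1 / W) * emeasure (density lborel p) A \<le> emeasure (mh_kernel p q x) A"
proof -
  have "AE x in density lborel p. 0 < p x \<and> p x \<le> W * q x"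
    using W(2) by (auto simp: AE_density)
  then show ?thesis
  proof (eventually_elim, safe)
    fix x and A :: "'a set" assume x: "0 < p x" "p x \<le> W * q x" and A[measurable]: "A \<in> sets borel"
    have "ennreal (1 / W) * emeasure (density lborel p) A
        = (\<integral>\<^sup>+y. ennreal (1 / W) * (ennreal (p y) * indicator A y) \<partial>lborel)"
      by (simp add: emeasure_density nn_integral_cmult)
    also have "\<dots> \<le> (\<integral>\<^sup>+y. ennreal (q y) * (ennreal (accept_prob p q x y) * indicator A y
          + ennreal (1 - accept_prob p q x y) * indicator A x) \<partial>lborel)"
    proof (rule nn_integral_mono_AE)
      show "AE y in lborel. ennreal (1 / W) * (ennreal (p y) * indicator A y)
          \<le> ennreal (q y) * (ennreal (accept_prob p q x y) * indicator A y
          + ennreal (1 - accept_prob p q x y) * indicator A x)"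
        using W(2)
      proof eventually_elim
        case (elim y)
        have "p x * (1 / W * p y) \<le> min (p y * q x) (p x * q y)"
          using x(2) elim W(1) mult_left_mono[OF x(2) pq_nonneg(1)[of y]]
            mult_left_mono[OF elim pq_nonneg(1)[of x]]
          by (simp add: field_simps)
        then have "1 / W * p y \<le> q y * accept_prob p q x y"
          using x(1) by (simp only: accepted_flow[of p q x y, OF pq_nonneg, symmetric] mult_le_cancel_left_pos)
        then have "ennreal (1 / W) * ennreal (p y) \<le> ennreal (q y) * ennreal (accept_prob p q x y)"
          using W(1) by (simp add: pq_nonneg \<alpha>_bounds flip: ennreal_mult)
        then show ?case
          by (cases "y \<in> A") (auto simp: distrib_left intro: order_trans add_increasing2)
      qed
    qed
    finally show "ennreal (1 / W) * emeasure (density lborel p) A \<le> emeasure (mh_kernel p q x) A"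
      by (simp add: emeasure_mh_kernel)
  qed
qed

text \<open>
  The essential supremum only controls \<open>p / q\<close> where \<open>q\<close> is positive. Absolute continuity covers the
  rest: \<open>p\<close> vanishes almost everywhere on the zero set of \<open>q\<close>. The bound \<open>p \<le> W * q\<close> is thus valid almost
  everywhere for Lebesgue measure, and integrating it gives \<open>1 \<le> W\<close>.
\<close>
lemma weight_sup_bound:
  assumes ac: "absolutely_continuous (density lborel q) (density lborel p)"
    and fin: "weight_sup p q < \<infinity>"
  shows "1 \<le> real_of_ereal (weight_sup p q)"
    and "AE x in lborel. p x \<le> real_of_ereal (weight_sup p q) * q x"
proof -
  interpret Q: prob_space "density lborel q" by (rule prob_density_prob_space[OF q])
  define W where "W = real_of_ereal (weight_sup p q)"
  have le: "AE x in density lborel q. ereal (weight p q x) \<le> weight_sup p q"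
    unfolding weight_sup_def by (rule esssup_AE)
  have "AE x in density lborel q. ereal 0 \<le> weight_sup p q"
    using le by eventually_elim (rule order_trans[rotated], auto simp: weight_def pq_nonneg)
  then have "0 \<le> weight_sup p q" by (simp add: zero_ereal_def)
  then have W: "weight_sup p q = ereal W"
    using fin unfolding W_def by (cases "weight_sup p q") auto
  have "emeasure (density lborel q) {x. q x = 0} = 0"
    by (simp add: emeasure_density nn_integral_0_iff_AE indicator_def of_bool_def)
  then have "{x. q x = 0} \<in> null_sets (density lborel p)"
    using ac unfolding absolutely_continuous_def by (auto intro!: null_setsI)
  then have "AE x in density lborel p. q x \<noteq> 0"
    using AE_not_in by fastforce
  then have "AE x in lborel. 0 < p x \<longrightarrow> q x \<noteq> 0"
    by (simp add: AE_density)
  moreover have "AE x in lborel. 0 < q x \<longrightarrow> weight p q x \<le> W"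
    using le unfolding W by (simp add: AE_density)
  ultimately show ae: "AE x in lborel. p x \<le> W * q x"
  proof eventually_elim
    case (elim x)
    then show ?case
      using pq_nonneg(1)[of x] pq_nonneg(2)[of x]
      by (cases "q x = 0") (auto simp: weight_def field_simps)
  qed
  have "1 = (\<integral>\<^sup>+x. ennreal (p x) \<partial>lborel)"
    using p by (simp add: prob_density_def)
  also have "\<dots> \<le> (\<integral>\<^sup>+x. ennreal W * ennreal (q x) \<partial>lborel)"
    using ae by (intro nn_integral_mono_AE)
      (auto simp: ennreal_mult''[symmetric] pq_nonneg intro: ennreal_leI)
  also have "\<dots> = ennreal W"
    using q by (simp add: nn_integral_cmult prob_density_def)
  finally show "1 \<le> W" by simp
qed

end

section \<open>The bound on the integrated autocorrelation time\<close>

theorem lemma2: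
  fixes p q :: "real ^ 'n \<Rightarrow> real"
    and g :: "real ^ 'n \<Rightarrow> real"
    and \<Omega> :: "'w measure"
    and X :: "nat \<Rightarrow> 'w \<Rightarrow> real ^ 'n"
    and a :: real
  assumes "prob_density p"
    and "prob_density q"
    and "absolutely_continuous (density lborel q) (density lborel p)"
    and "weight_sup p q < \<infinity>"
    and "a = 1 - 1 / real_of_ereal (weight_sup p q)"
    and "markov_chain \<Omega> X (density lborel p) (mh_kernel p q)"
    and "g \<in> borel_measurable borel"
    and "integrable (density lborel p) (\<lambda>x. (g x)\<^sup>2)"
    and "\<not> (\<exists>c. AE x in density lborel p. g x = c)"
  shows "summable (\<lambda>t. autocorrelation \<Omega> X g (Suc t)) \<and>
         autocorrelation_time \<Omega> X g \<le> (1 + a) / (1 - a)"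
proof -
  let ?\<pi> = "density lborel p" and ?K = "mh_kernel p q"
  define W where "W = real_of_ereal (weight_sup p q)"
  note p = assms(1) and q = assms(2) and mc = assms(6)
  have W: "1 \<le> W" "AE x in lborel. p x \<le> W * q x"
    unfolding W_def by (rule weight_sup_bound[OF p q assms(3,4)])+
  have a: "a = 1 - 1 / W" "0 \<le> a" "a < 1"
    using W(1) assms(5) by (auto simp: W_def)
  note K = measurable_mh_kernel[OF p q] and inv = mh_kernel_invariant[OF p q]
  have X: "X n \<in> borel_measurable \<Omega>" for n
    using mc by (simp add: markov_chain_def)
  have \<Omega>: "prob_space \<Omega>"
    using mc by (simp add: markov_chain_def)
  have cov: "\<bar>covariance \<Omega> (\<lambda>\<omega>. g (X 0 \<omega>)) (\<lambda>\<omega>. g (X t \<omega>))\<bar>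
      \<le> a ^ t * prob_space.variance \<Omega> (\<lambda>\<omega>. g (X 0 \<omega>))" for t
  proof -
    have "scale_measure (ennreal (1 - (1 - 1 / W) ^ t)) (?\<pi> \<Otimes>\<^sub>M ?\<pi>)
        \<le> distr \<Omega> (borel \<Otimes>\<^sub>M borel) (\<lambda>\<omega>. (X 0 \<omega>, X t \<omega>))"
      using mh_kernel_minorized[OF p q _ W(2)] W(1)
      by (intro markov_chain_joint_law_minorized[OF mc K inv]) auto
    moreover have "0 \<le> 1 - a ^ t"
      using a by (simp add: power_le_one)
    ultimately have "\<bar>covariance \<Omega> (\<lambda>\<omega>. g (X 0 \<omega>)) (\<lambda>\<omega>. g (X t \<omega>))\<bar>
      \<le> (1 - (1 - a ^ t)) * prob_space.variance \<Omega> (\<lambda>\<omega>. g (X 0 \<omega>))"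
      by (intro covariance_le_of_minorized_law[OF \<Omega> X X markov_chain_stationary[OF mc K inv]
            markov_chain_stationary[OF mc K inv] _ _ assms(7,8)]) (simp_all add: a(1))
    then show ?thesis by simp
  qed
  \<comment> \<open>If the variance is 0, the quotient is 0 by convention and the bound is trivial.\<close>
  have \<rho>: "\<bar>autocorrelation \<Omega> X g t\<bar> \<le> a ^ t" for t
  proof -
    define v where "v = prob_space.variance \<Omega> (\<lambda>\<omega>. g (X 0 \<omega>))"
    have "0 \<le> v"
      by (simp add: v_def)
    with cov[of t] a(2) show ?thesis
      unfolding autocorrelation_def abs_divide v_def[symmetric]
      by (cases "v = 0") (auto simp: pos_divide_le_eq)
  qed
  have geo: "(\<lambda>t. a ^ Suc t) sums (a * (1 / (1 - a)))"
    using a geometric_sums[of a] sums_mult[of "\<lambda>t. a ^ t" _ a] by simp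
  have summ: "summable (\<lambda>t. autocorrelation \<Omega> X g (Suc t))"
    by (rule summable_comparison_test'[OF sums_summable[OF geo], of 0]) (use \<rho>[of "Suc _"] in simp)
  have "(\<Sum>t. autocorrelation \<Omega> X g (Suc t)) \<le> a * (1 / (1 - a))"
    unfolding sums_unique[OF geo]
    by (rule suminf_le[OF _ summ sums_summable[OF geo]]) (use \<rho>[of "Suc _"] abs_le_D1 in blast)
  then have "autocorrelation_time \<Omega> X g \<le> 1 + 2 * (a * (1 / (1 - a)))"
    unfolding autocorrelation_time_def by simp
  also have "\<dots> = (1 + a) / (1 - a)"
    using a(3) by (simp add: field_simps)
  finally show ?thesis
    using summ by simp
qed

end
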